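(* There exist absolute constants $c,C>0$ such that the following holds: for any finite set $A$ of positive real numbers, any real $K>0$ and any $t \in \mathbb{R}\setminus\{0\}$, \[ |AA| \leq K|A| \implies |\{(a,b) \in A\times A : a-b=t\}| \ll K^{C}|A|^{\frac{2}{3}-c}. \]
   Context: $AA := \{ab : a,b \in A\}$ is the product set, and $|\cdot|$ denotes cardinality. $X \ll Y$ means $X \leq C_0 Y$ for some absolute constant $C_0>0$ (independent of $A$, $K$ and $t$). *)

theory Defs
  imports Complex_Main "HOL-Library.Set_Algebras"
begin

end

theory Submission
  imports Defs
begin

text \<open>
  Let \<open>L = ln A\<close> and \<open>D\<^sub>j = jL - jL\<close>; by the Pluennecke--Ruzsa inequality \<open>D\<^sub>j\<close> has size
  \<open>K\<^sup>O\<^sup>(\<^sup>1\<^sup>) N\<close> with \<open>N = |A|\<close>. Suppose \<open>X = A \<inter> (A + t)\<close> has \<open>M\<close> elements. If a set with \<open>m\<close>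
  elements is \<open>q\<close>-separated, its translates by \<open>D\<^sub>j \<inter> [0, q)\<close> are disjoint. Hence most gaps
  between consecutive elements of \<open>ln X\<close> and of \<open>ln (X - t)\<close> lie in pieces \<open>D\<^sub>j \<inter> [0, q]\<close> with about
  \<open>N/M\<close> elements, and some gap \<open>h\<close> of \<open>ln (X - t)\<close> occurs at least about \<open>M\<^sup>2/N\<close> times.

  If \<open>a < a'\<close> are consecutive in \<open>X\<close> with \<open>ln (a' - t) - ln (a - t) = h\<close>, then \<open>z = ln a' - ln a\<close>
  satisfies \<open>1 - exp (-z) = (exp h - 1) (a - t) / a'\<close>. So for a set \<open>Z\<close> of about \<open>M\<^sup>2/N\<close> numbers in
  a piece of \<open>D\<^sub>1\<close> of size about \<open>N/M\<close>, the values \<open>ln (1 - exp (-z))\<close> lie in a translate of \<open>D\<^sub>1\<close>.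
  When \<open>M\<close> is near \<open>N\<^sup>2\<^sup>/\<^sup>3\<close>, the set \<open>Z\<close> fills a positive proportion of that piece, and one can
  repeatedly pass to the \<open>z\<close> with a popular gap \<open>h\<close> and replace \<open>r z\<close> by \<open>r z - r (z + h)\<close>. Each
  step keeps a positive proportion of \<open>Z\<close> and divides by \<open>|Z|\<close>, about \<open>N\<^sup>1\<^sup>/\<^sup>3\<close>, the number of values
  available to \<open>r\<close>. As \<open>r\<close> stays injective, three steps bound \<open>N\<^sup>1\<^sup>/\<^sup>3\<close>; quantitatively,
  \<open>M\<^sup>4\<^sup>1\<close> is at most a constant times \<open>(K\<^sup>3\<^sup>4\<^sup>0 N)\<^sup>2\<^sup>7\<close>, and \<open>27/41 = 2/3 - 1/123\<close>.
\<close>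

section \<open>Iterated sumsets\<close>

lemma card_set_plus_singleton:
  fixes X :: "'a::ab_group_add set"
  shows "card (X + {c}) = card X"
proof -
  have "X + {c} = (\<lambda>x. x + c) ` X"
    by (auto simp: set_plus_def)
  thus ?thesis
    by (simp add: card_image inj_on_def)
qed

text \<open>Induction on \<open>C\<close>: the translates of \<open>A\<close> by
  \<open>x + c\<close> with \<open>x \<in> Z\<close> are already covered, which saves
  \<open>card (Z + A)\<close> new sums, and the minimality of \<open>X\<close> bounds this saving
  below in terms of \<open>card Z\<close>. Cross-multiplying the ratio
  \<open>card (X + A) / card X\<close> admits an empty \<open>Z\<close>.\<close>

lemma petridis:
  fixes X A C :: "'a::ab_group_add set"
  assumes "finite X" "finite A" "finite C"
    and min: "\<And>Z. Z \<subseteq> X \<Longrightarrow> card (X + A) * card Z \<le> card (Z + A) * card X"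
  shows "card (X + A + C) * card X \<le> card (X + A) * card (X + C)"
  using \<open>finite C\<close>
proof (induction C rule: finite_induct)
  case empty
  show ?case by (simp add: set_plus_def)
next
  case (insert c C)
  define Z where "Z = {x \<in> X. {x} + A + {c} \<subseteq> X + A + C}"
  \<comment> \<open>\<open>W\<close> measures the overlap of \<open>X + {c}\<close> with
    \<open>X + C\<close>; such an overlap forces the whole translate of \<open>A\<close> to be
    covered, so \<open>W \<subseteq> Z\<close>.\<close>
  define W where "W = {x \<in> X. x + c \<in> X + C}"
  have fin: "finite (X + A)" "finite (X + A + C)" "finite (X + C)" "finite Z" "finite W"
      "finite (Z + A)"
    using assms(1,2) insert(1) by (auto simp: Z_def W_def intro!: finite_set_plus)
  have "W \<subseteq> Z"
  proof
    fix x assume "x \<in> W"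
    then obtain y d where y: "y \<in> X" "d \<in> C" "x \<in> X" "x + c = y + d"
      by (auto simp: W_def set_plus_def)
    have "x + a + c \<in> X + A + C" if "a \<in> A" for a
    proof -
      have eq: "x + a + c = y + a + d"
        using y(4) by (metis add.commute add.left_commute)
      show ?thesis unfolding eq by (intro set_plus_intro y that)
    qed
    thus "x \<in> Z" using y by (auto simp: Z_def set_plus_def)
  qed
  have ZA: "Z + A \<subseteq> X + A"
    by (intro set_plus_mono2) (auto simp: Z_def)
  have "X + A + insert c C \<subseteq> (X + A + C) \<union> (X + A - (Z + A) + {c})"
  proof
    fix w assume "w \<in> X + A + insert c C"
    then obtain x a d where w: "w = x + a + d" "x \<in> X" "a \<in> A" "d \<in> insert c C"
      by (auto simp: set_plus_def)
    show "w \<in> (X + A + C) \<union> (X + A - (Z + A) + {c})"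
    proof (cases "d \<in> C")
      case True
      thus ?thesis using w by (auto intro!: set_plus_intro)
    next
      case False
      hence "d = c" using w by auto
      show ?thesis
      proof (cases "x + a \<in> Z + A")
        case True
        then obtain z b where z: "z \<in> Z" "b \<in> A" "x + a = z + b"
          by (auto simp: set_plus_def)
        have "w \<in> {z} + A + {c}"
          unfolding w(1) \<open>d = c\<close> z(3) using z(2) by (intro set_plus_intro) auto
        thus ?thesis using \<open>z \<in> Z\<close> by (auto simp: Z_def)
      next
        case False
        hence "x + a \<in> X + A - (Z + A)" using set_plus_intro[OF w(2,3)] by blast
        thus ?thesis unfolding w(1) \<open>d = c\<close> by (intro UnI2 set_plus_intro) auto
      qed
    qed
  qed
  hence "card (X + A + insert c C) \<le> card ((X + A + C) \<union> (X + A - (Z + A) + {c}))"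
    using fin by (intro card_mono) (auto intro!: finite_set_plus)
  also have "\<dots> \<le> card (X + A + C) + card (X + A - (Z + A) + {c})"
    by (rule card_Un_le)
  also have "card (X + A - (Z + A) + {c}) = card (X + A) - card (Z + A)"
    using fin ZA by (simp add: card_set_plus_singleton card_Diff_subset)
  finally have 1: "card (X + A + insert c C) + card (Z + A) \<le> card (X + A + C) + card (X + A)"
    using card_mono[OF fin(1) ZA] by linarith
  have "(X + C) \<union> (X - W + {c}) \<subseteq> X + insert c C"
    by (auto simp: set_plus_def)
  hence "card ((X + C) \<union> (X - W + {c})) \<le> card (X + insert c C)"
    using assms(1) insert(1) by (intro card_mono) (auto intro!: finite_set_plus)
  moreover have "(X + C) \<inter> (X - W + {c}) = {}"
    by (auto simp: W_def elim!: set_plus_elim[of _ "X - _"])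
  hence "card ((X + C) \<union> (X - W + {c})) = card (X + C) + card (X - W + {c})"
    using fin assms(1) insert(1) by (intro card_Un_disjoint finite_set_plus) auto
  moreover have "card (X - W + {c}) = card X - card W"
    using fin by (subst card_set_plus_singleton, intro card_Diff_subset) (auto simp: W_def)
  moreover have "card W \<le> card X"
    using assms(1) by (intro card_mono) (auto simp: W_def)
  ultimately have 2: "card (X + C) + card X \<le> card (X + insert c C) + card W"
    by linarith
  have "card (X + A) * card W \<le> card (X + A) * card Z"
    using \<open>W \<subseteq> Z\<close> fin by (intro mult_left_mono card_mono) auto
  also have "\<dots> \<le> card (Z + A) * card X"
    by (rule min) (auto simp: Z_def)
  finally have 3: "card (X + A) * card W \<le> card (Z + A) * card X" .
  have "card (X + A + insert c C) * card X + card (Z + A) * card X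
      \<le> card (X + A + C) * card X + card (X + A) * card X"
    using mult_right_mono[OF 1, of "card X"] by (simp add: algebra_simps)
  also have "\<dots> \<le> card (X + A) * (card (X + C) + card X)"
    using insert.IH by (simp add: algebra_simps)
  also have "\<dots> \<le> card (X + A) * (card (X + insert c C) + card W)"
    using 2 by (rule mult_left_mono) simp
  also have "\<dots> \<le> card (X + A) * card (X + insert c C) + card (Z + A) * card X"
    using 3 by (simp add: algebra_simps)
  finally show ?case by simp
qed

text \<open>Fix one representation \<open>d = p d - q d\<close> of each difference. The pair
  \<open>(x + p d, x + q d)\<close> determines \<open>d\<close> as the difference of its
  coordinates, and then \<open>x\<close>.\<close>

lemma ruzsa_triangle:
  fixes X A B :: "'a::ab_group_add set"
  assumes "finite X" "finite A" "finite B"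
  shows "card {a - b |a b. a \<in> A \<and> b \<in> B} * card X \<le> card (X + A) * card (X + B)"
proof -
  define D where "D = {a - b |a b. a \<in> A \<and> b \<in> B}"
  have "\<forall>d\<in>D. \<exists>a b. a \<in> A \<and> b \<in> B \<and> d = a - b"
    by (auto simp: D_def)
  then obtain p q where pq: "\<And>d. d \<in> D \<Longrightarrow> p d \<in> A \<and> q d \<in> B \<and> d = p d - q d"
    by metis
  have "inj_on (\<lambda>(d, x). (x + p d, x + q d)) (D \<times> X)"
  proof (rule inj_onI, clarify)
    fix d x e y assume *: "d \<in> D" "e \<in> D" "x + p d = y + p e" "x + q d = y + q e"
    have "p d - q d = (x + p d) - (x + q d)" "p e - q e = (y + p e) - (y + q e)"
      by simp_all
    hence "d = e" using * pq by metis
    thus "d = e \<and> x = y" using * by auto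
  qed
  moreover have "(\<lambda>(d, x). (x + p d, x + q d)) ` (D \<times> X) \<subseteq> (X + A) \<times> (X + B)"
    using pq by (auto intro!: set_plus_intro)
  ultimately have "card (D \<times> X) \<le> card ((X + A) \<times> (X + B))"
    using assms by (intro card_inj_on_le) (auto intro!: finite_set_plus)
  thus ?thesis by (simp add: card_cartesian_product D_def)
qed

section \<open>Iterated sums, their differences and the Pluennecke--Ruzsa inequality\<close>

primrec isum :: "'a::ab_group_add set \<Rightarrow> nat \<Rightarrow> 'a set" where
  "isum A 0 = {0}"
| "isum A (Suc n) = A + isum A n"

definition dsum :: "'a::ab_group_add set \<Rightarrow> nat \<Rightarrow> 'a set" where
  "dsum A n = {x - y |x y. x \<in> isum A n \<and> y \<in> isum A n}"

lemma finite_isum [intro]: "finite A \<Longrightarrow> finite (isum A n)"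
  by (induction n) (auto intro!: finite_set_plus)

lemma finite_dsum [intro, simp]:
  assumes "finite A" shows "finite (dsum A n)"
proof -
  have "dsum A n = (\<lambda>(x, y). x - y) ` (isum A n \<times> isum A n)"
    by (auto simp: dsum_def)
  thus ?thesis using finite_isum[OF assms] by auto
qed

lemma isum_add: "isum A (m + n) = isum A m + isum A n"
  by (induction m) (auto simp: set_plus_def add.assoc, (metis add.assoc)+)

lemma dsum_add:
  assumes "x \<in> dsum A m" "y \<in> dsum A n" shows "x + y \<in> dsum A (m + n)"
proof -
  obtain a b c d where "a \<in> isum A m" "b \<in> isum A m" "c \<in> isum A n" "d \<in> isum A n"
      "x = a - b" "y = c - d"
    using assms by (auto simp: dsum_def)
  moreover from this have "x + y = (a + c) - (b + d)"
    by (simp add: algebra_simps)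
  ultimately show ?thesis
    unfolding dsum_def isum_add by (blast intro: set_plus_intro)
qed

lemma dsum_uminus: "x \<in> dsum A m \<Longrightarrow> - x \<in> dsum A m"
  by (force simp: dsum_def)

lemma dsum_diff:
  assumes "x \<in> dsum A m" "y \<in> dsum A n" shows "x - y \<in> dsum A (m + n)"
  using dsum_add[OF assms(1) dsum_uminus[OF assms(2)]] by simp

lemma dsum_1I: "a \<in> A \<Longrightarrow> b \<in> A \<Longrightarrow> a - b \<in> dsum A 1"
  by (auto simp: dsum_def set_plus_def)

lemma zero_in_dsum: "A \<noteq> {} \<Longrightarrow> 0 \<in> dsum A n"
proof -
  assume "A \<noteq> {}"
  hence "isum A n \<noteq> {}"
    by (induction n) (auto simp: set_plus_def)
  then obtain x where "x \<in> isum A n" by blast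
  thus ?thesis unfolding dsum_def by force
qed

text \<open>For a subset \<open>X\<close> of \<open>A\<close> with least ratio
  \<open>r X \<le> K\<close>, \<open>petridis\<close> gives growth by a factor \<open>r X\<close>
  per summand; \<open>ruzsa_triangle\<close> through \<open>X\<close> then turns sums into
  differences, which doubles the exponent.\<close>

lemma card_dsum_le:
  fixes A :: "'a::ab_group_add set" and K :: real
  assumes "finite A" "A \<noteq> {}" and K: "card (A + A) \<le> K * card A"
  shows "card (dsum A n) \<le> K ^ (2 * n) * card A"
proof -
  define r where "r X = real (card (X + A)) / card X" for X
  define F where "F = Pow A - {{}}"
  have F: "finite F" "A \<in> F" using assms by (auto simp: F_def)
  define X where "X = arg_min_on r F"
  have XF: "X \<in> F" and Xmin: "\<And>Z. Z \<in> F \<Longrightarrow> r X \<le> r Z"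
    using F arg_min_if_finite(1)[of F r] arg_min_least[of F _ r] by (auto simp: X_def)
  have X: "finite X" "X \<noteq> {}" "X \<subseteq> A" "card X > 0"
    using XF assms(1) finite_subset by (auto simp: F_def card_gt_0_iff)
  have "r X \<le> r A" using Xmin F by auto
  also have "\<dots> \<le> K"
    using K assms by (simp add: r_def divide_le_eq card_gt_0_iff)
  finally have rK: "r X \<le> K" .
  have r0: "r X \<ge> 0" by (simp add: r_def)
  have min: "card (X + A) * card Z \<le> card (Z + A) * card X" if "Z \<subseteq> X" for Z
  proof (cases "Z = {}")
    case False
    hence "Z \<in> F" "card Z > 0"
      using that X assms(1) finite_subset by (auto simp: F_def card_gt_0_iff)
    hence "real (card (X + A) * card Z) \<le> real (card (Z + A) * card X)"
      using Xmin[of Z] X by (simp add: r_def divide_simps mult.commute)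
    thus ?thesis by linarith
  qed auto
  have iter: "card (X + isum A n) \<le> r X ^ n * card X" for n
  proof (induction n)
    case (Suc n)
    have "card (X + A + isum A n) * card X \<le> card (X + A) * card (X + isum A n)"
      using X assms(1) min by (intro petridis) auto
    hence "real (card (X + A + isum A n)) * card X \<le> real (card (X + A)) * card (X + isum A n)"
      by (metis of_nat_le_iff of_nat_mult)
    hence "real (card (X + isum A (Suc n))) \<le> r X * card (X + isum A n)"
      using X by (simp add: r_def field_simps add.assoc)
    also have "\<dots> \<le> r X * (r X ^ n * card X)"
      using Suc r0 by (intro mult_left_mono) auto
    finally show ?case by (simp add: mult_ac)
  qed (simp add: set_plus_def)
  have "card (dsum A n) * card X \<le> card (X + isum A n) * card (X + isum A n)"
    unfolding dsum_def using X assms(1) by (intro ruzsa_triangle) auto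
  hence "real (card (dsum A n)) * card X \<le> real (card (X + isum A n)) * card (X + isum A n)"
    by (metis of_nat_le_iff of_nat_mult)
  also have "\<dots> \<le> (r X ^ n * card X) * (r X ^ n * card X)"
    using iter r0 by (intro mult_mono) auto
  finally have "real (card (dsum A n)) \<le> r X ^ (2 * n) * card X"
    using X by (simp add: mult_ac power_add mult_2_right)
  also have "\<dots> \<le> K ^ (2 * n) * card A"
    using rK r0 X assms(1) by (intro mult_mono power_mono) (auto intro: card_mono)
  finally show ?thesis .
qed

section \<open>Gaps between consecutive elements\<close>

abbreviation dsum_upto :: "real set \<Rightarrow> nat \<Rightarrow> real \<Rightarrow> real set" where
  "dsum_upto A n d \<equiv> dsum A n \<inter> {0..d}"

text \<open>Subtracting the least element of \<open>S\<close> cancels the shift \<open>c\<close> and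
  moves \<open>S\<close> to \<open>[0, d]\<close>; the price is the order \<open>2 * n\<close> of a
  difference of two elements of \<open>dsum A n\<close>.\<close>

lemma card_dsum_interval:
  fixes A S :: "real set"
  assumes "finite A" "finite S" "S \<subseteq> (+) c ` dsum A n \<inter> {b..b + d}"
  shows "card S \<le> card (dsum_upto A (2 * n) d)"
proof (cases "S = {}")
  case False
  define m where "m = Min S"
  have m: "m \<in> S" "\<And>x. x \<in> S \<Longrightarrow> m \<le> x"
    using assms(2) False by (auto simp: m_def)
  have "(\<lambda>x. x - m) ` S \<subseteq> dsum_upto A (2 * n) d"
  proof (clarify)
    fix x assume x: "x \<in> S"
    obtain g h where gh: "g \<in> dsum A n" "h \<in> dsum A n" "x = c + g" "m = c + h"
      using assms(3) x m(1) by blast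
    have "x - m \<in> dsum A (2 * n)"
      using dsum_diff[OF gh(1,2)] gh(3,4) by (simp add: mult_2)
    moreover have "x \<le> b + d" "b \<le> m" using assms(3) x m(1) by auto
    ultimately show "x - m \<in> dsum_upto A (2 * n) d"
      using m(2)[OF x] by auto
  qed
  thus ?thesis
    using assms(1) by (intro card_inj_on_le[of "\<lambda>x. x - m"]) (auto simp: inj_on_def)
qed simp

lemma card_dsum_double_interval:
  fixes A S :: "real set"
  assumes "finite A" "finite S" "S \<subseteq> (+) c ` dsum A n \<inter> {b..b + 2 * d}"
  shows "card S \<le> 2 * card (dsum_upto A (2 * n) d)"
proof -
  have "S = (S \<inter> {..b + d}) \<union> (S \<inter> {b + d..})" by auto
  hence "card S \<le> card (S \<inter> {..b + d}) + card (S \<inter> {b + d..})"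
    by (metis card_Un_le)
  moreover have "card (S \<inter> {..b + d}) \<le> card (dsum_upto A (2 * n) d)"
    using assms by (intro card_dsum_interval[where c = c and b = b]) auto
  moreover have "card (S \<inter> {b + d..}) \<le> card (dsum_upto A (2 * n) d)"
    using assms by (intro card_dsum_interval[where c = c and b = "b + d"]) (auto simp: algebra_simps)
  ultimately show ?thesis by linarith
qed

text \<open>Take the largest candidate among 0 and the values reached by at least
  \<open>k / 4\<close> indices: were it exceeded too often, the least value above it would be a
  larger candidate. \<open>k\<close> is independent of \<open>card I\<close> because a set of points
  has one gap fewer than points.\<close>

lemma quantile_exists:
  fixes f :: "'a \<Rightarrow> real"
  assumes "finite I" "\<And>i. i \<in> I \<Longrightarrow> f i \<ge> 0"
  obtains q where "q \<ge> 0" "4 * card {i \<in> I. f i > q} \<le> k"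
    "q = 0 \<or> q \<in> f ` I \<and> 4 * card {i \<in> I. f i \<ge> q} \<ge> k"
proof -
  define V where "V = {v \<in> insert 0 (f ` I). v = 0 \<or> 4 * card {i \<in> I. f i \<ge> v} \<ge> k}"
  define q where "q = Max V"
  have V: "finite V" "0 \<in> V" using assms(1) by (auto simp: V_def)
  have q: "q \<in> V" unfolding q_def using V by (intro Max_in) auto
  have "4 * card {i \<in> I. f i > q} \<le> k"
  proof (rule ccontr)
    assume *: "\<not> ?thesis"
    define J where "J = {i \<in> I. f i > q}"
    have J: "finite J" "J \<noteq> {}"
      using * assms(1) unfolding J_def by (simp, metis card.empty mult_0_right zero_le)
    define v where "v = Min (f ` J)"
    have v: "v \<in> f ` J" "\<And>i. i \<in> J \<Longrightarrow> v \<le> f i"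
      using J by (auto simp: v_def)
    have "J \<subseteq> {i \<in> I. f i \<ge> v}" using v(2) by (auto simp: J_def)
    hence "card J \<le> card {i \<in> I. f i \<ge> v}" using assms(1) by (intro card_mono) auto
    hence "v \<in> V" using v(1) * by (auto simp: V_def J_def)
    hence "v \<le> q" using V by (simp add: q_def)
    thus False using v(1) by (auto simp: J_def)
  qed
  moreover have "q \<ge> 0" using V by (simp add: q_def)
  ultimately show ?thesis using q by (intro that) (auto simp: V_def)
qed

text \<open>At \<open>y = Max Y\<close> the minimum is over the empty set, so gaps are indexed by
  \<open>Y - {Max Y}\<close>.\<close>

definition succ_in :: "real set \<Rightarrow> real \<Rightarrow> real" where
  "succ_in Y y = Min {x \<in> Y. x > y}"

lemma succ_in:
  assumes "finite Y" "y \<in> Y - {Max Y}"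
  shows "succ_in Y y \<in> Y" "y < succ_in Y y" "\<And>z. z \<in> Y \<Longrightarrow> y < z \<Longrightarrow> succ_in Y y \<le> z"
proof -
  have "Max Y \<in> {x \<in> Y. x > y}"
    using assms Max_ge[of Y y] by (auto simp: less_le intro!: Max_in)
  hence "finite {x \<in> Y. x > y}" "{x \<in> Y. x > y} \<noteq> {}"
    using assms by auto
  from Min_in[OF this] Min_le[OF this(1)]
  show "succ_in Y y \<in> Y" "y < succ_in Y y" "\<And>z. z \<in> Y \<Longrightarrow> y < z \<Longrightarrow> succ_in Y y \<le> z"
    by (auto simp: succ_in_def)
qed

text \<open>\<open>q\<close> is an upper quartile of the gaps of \<open>f\<close>. If
  \<open>q > 0\<close>, a quarter of the points have gaps at least \<open>q\<close>, so the
  translates of \<open>dsum A j \<inter> {0..<q}\<close> by their values are disjoint, and they fit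
  into an interval of length \<open>2 * d\<close>. One \<open>q\<close> serves all orders
  \<open>j\<close>.\<close>

lemma gap_bound:
  fixes f :: "real \<Rightarrow> real" and A Y :: "real set"
  assumes "finite A" "A \<noteq> {}" "finite Y" and mono: "strict_mono_on Y f"
    and range: "f ` Y \<subseteq> (+) c ` dsum A i \<inter> {b..b + d}"
  obtains q where "q \<ge> 0"
    "4 * card {y \<in> Y - {Max Y}. f (succ_in Y y) - f y > q} \<le> card Y"
    "\<And>j. card Y * card (dsum_upto A j q) \<le> 16 * card (dsum_upto A (2 * (i + j)) d)"
proof (cases "Y = {}")
  case True
  thus ?thesis by (intro that[of 0]) auto
next
  case False
  define g where "g y = f (succ_in Y y) - f y" for y
  have g: "g y \<ge> 0" if "y \<in> Y - {Max Y}" for y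
    using succ_in[OF assms(3) that] that strict_mono_onD[OF mono, of y "succ_in Y y"]
    by (auto simp: g_def)
  obtain q where q: "q \<ge> 0" "4 * card {y \<in> Y - {Max Y}. g y > q} \<le> card Y"
    "q = 0 \<or> q \<in> g ` (Y - {Max Y}) \<and> 4 * card {y \<in> Y - {Max Y}. g y \<ge> q} \<ge> card Y"
    using quantile_exists[of "Y - {Max Y}" g "card Y"] g assms(3) by blast
  have Ybnd: "b \<le> f y" "f y \<le> b + d" if "y \<in> Y" for y
    using range that by auto
  have zero: "0 \<in> dsum A j" for j using assms(2) by (rule zero_in_dsum)
  have "card Y * card (dsum_upto A j q) \<le> 16 * card (dsum_upto A (2 * (i + j)) d)" for j
  proof (cases "q = 0")
    case True
    have "v \<in> dsum A (i + j)" if "v \<in> dsum A i" for v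
      using dsum_add[OF that zero[of j]] by simp
    hence "f ` Y \<subseteq> (+) c ` dsum A (i + j) \<inter> {b..b + d}"
      using range by blast
    hence "card (f ` Y) \<le> card (dsum_upto A (2 * (i + j)) d)"
      using assms by (intro card_dsum_interval) auto
    moreover have "card (f ` Y) = card Y"
      by (intro card_image strict_mono_on_imp_inj_on mono)
    moreover have "dsum_upto A j q = {0}" using True zero by auto
    ultimately show ?thesis by simp
  next
    case False
    define P where "P = {y \<in> Y - {Max Y}. g y \<ge> q}"
    \<comment> \<open>Half-open for disjointness; restoring the endpoint \<open>q\<close> costs a
      factor 2, as \<open>0 \<in> S\<close>. With 4 from the quartile and 2 from the interval of
      double length this makes 16.\<close>
    define S where "S = dsum A j \<inter> {0..<q}"
    have fin: "finite P" "finite S" using assms by (auto simp: P_def S_def)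
    have qd: "q \<le> d"
    proof -
      obtain y where "y \<in> Y - {Max Y}" "q = g y" using q(3) False by auto
      thus ?thesis using Ybnd[of y] Ybnd[of "succ_in Y y"] succ_in[OF assms(3), of y]
        by (auto simp: g_def)
    qed
    have disj: "f y + s < f z + t" if "y \<in> P" "z \<in> P" "s \<in> S" "t \<in> S" "y < z" for y z s t
    proof -
      have y: "y \<in> Y - {Max Y}" using that by (auto simp: P_def)
      have "f y + s < f (succ_in Y y)" using that by (auto simp: P_def S_def g_def)
      also have "\<dots> \<le> f z"
        using succ_in[OF assms(3) y] that strict_mono_onD[OF mono, of "succ_in Y y" z]
        by (cases "succ_in Y y = z") (force simp: P_def)+
      also have "\<dots> \<le> f z + t" using that by (auto simp: S_def)
      finally show ?thesis .
    qed
    have "inj_on (\<lambda>(y, s). f y + s) (P \<times> S)"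
    proof (rule inj_onI, clarify)
      fix y s z t assume *: "y \<in> P" "s \<in> S" "z \<in> P" "t \<in> S" "f y + s = f z + t"
      hence "y = z" using disj[of y z s t] disj[of z y t s] by force
      thus "y = z \<and> s = t" using * by simp
    qed
    hence "card P * card S = card ((\<lambda>(y, s). f y + s) ` (P \<times> S))"
      by (simp add: card_image card_cartesian_product)
    also have "\<dots> \<le> 2 * card (dsum_upto A (2 * (i + j)) d)"
    proof (intro card_dsum_double_interval[where c = c and b = b] subsetI)
      fix x assume "x \<in> (\<lambda>(y, s). f y + s) ` (P \<times> S)"
      then obtain y s where ys: "y \<in> Y" "s \<in> S" "x = f y + s" by (auto simp: P_def)
      obtain e where "e \<in> dsum A i" "f y = c + e" using range ys by blast
      hence "x \<in> (+) c ` dsum A (i + j)"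
        using ys dsum_add[of e A i s j] by (auto simp: S_def add.assoc)
      thus "x \<in> (+) c ` dsum A (i + j) \<inter> {b..b + 2 * d}"
        using ys Ybnd[of y] qd by (auto simp: S_def)
    qed (use assms fin in auto)
    finally have 1: "card P * card S \<le> 2 * card (dsum_upto A (2 * (i + j)) d)" .
    have "dsum_upto A j q \<subseteq> insert q S" by (auto simp: S_def)
    hence "card (dsum_upto A j q) \<le> card (insert q S)" using fin by (intro card_mono) auto
    also have "\<dots> \<le> card S + 1" using fin by (simp add: card_insert_if)
    also have "\<dots> \<le> 2 * card S"
    proof -
      have "0 \<in> S" using zero q(1) False by (auto simp: S_def)
      thus ?thesis using fin by (auto simp: Suc_le_eq card_gt_0_iff)
    qed
    finally have "card Y * card (dsum_upto A j q) \<le> (4 * card P) * (2 * card S)"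
      using q(3) False by (intro mult_mono) (auto simp: P_def)
    thus ?thesis using 1 by simp
  qed
  thus ?thesis using q by (intro that[of q]) (auto simp: g_def)
qed

lemma pigeonhole_image:
  assumes "finite Y" "f ` Y \<subseteq> T" "finite T" "Y \<noteq> {}"
  obtains h where "h \<in> T" "card Y \<le> card {y \<in> Y. f y = h} * card T"
proof -
  have "\<exists>h\<in>T. card Y \<le> card {y \<in> Y. f y = h} * card T"
  proof (rule ccontr)
    assume "\<not> ?thesis"
    hence *: "card {y \<in> Y. f y = h} * card T < card Y" if "h \<in> T" for h
      using that by force
    have "T \<noteq> {}" using assms by auto
    have "Y = (\<Union>h\<in>T. {y \<in> Y. f y = h})" using assms by auto
    hence "card Y \<le> (\<Sum>h\<in>T. card {y \<in> Y. f y = h})"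
      by (metis card_UN_le assms(3))
    from mult_le_mono1[OF this, of "card T"]
    have "card Y * card T \<le> (\<Sum>h\<in>T. card {y \<in> Y. f y = h} * card T)"
      by (simp only: sum_distrib_right)
    also have "\<dots> < (\<Sum>h\<in>T. card Y)"
      using * assms(3) \<open>T \<noteq> {}\<close> by (intro sum_strict_mono) auto
    finally show False by simp
  qed
  thus ?thesis using that by blast
qed

text \<open>Discarding the maximum and the points with a large gap of \<open>f\<close> or of
  \<open>g\<close> leaves a quarter of \<open>Y\<close>. The remaining gaps of \<open>f\<close> take
  few values, so one value \<open>h\<close> is popular; the gaps of \<open>g\<close> are only
  confined to \<open>[0, q]\<close>.\<close>

lemma squeeze:
  fixes f g :: "real \<Rightarrow> real" and A Y :: "real set"
  assumes "finite A" "A \<noteq> {}" "finite Y" "card Y \<ge> 4"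
    and f: "strict_mono_on Y f" "f ` Y \<subseteq> (+) c ` dsum A i \<inter> {b..b + d}"
    and g: "strict_mono_on Y g" "g ` Y \<subseteq> (+) c' ` dsum A i' \<inter> {b'..b' + d'}"
  obtains Y' s h q where
    "Y' \<subseteq> Y" "\<And>y. y \<in> Y' \<Longrightarrow> s y \<in> Y \<and> y < s y \<and> f (s y) - f y = h"
    "\<And>y. y \<in> Y' \<Longrightarrow> g (s y) - g y \<in> dsum_upto A (2 * i') q"
    "(card Y)\<^sup>2 \<le> 64 * card Y' * card (dsum_upto A (6 * i) d)"
    "\<And>j. card Y * card (dsum_upto A j q) \<le> 16 * card (dsum_upto A (2 * (i' + j)) d')"
proof -
  obtain p where p: "p \<ge> 0"
    "4 * card {y \<in> Y - {Max Y}. f (succ_in Y y) - f y > p} \<le> card Y"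
    "\<And>j. card Y * card (dsum_upto A j p) \<le> 16 * card (dsum_upto A (2 * (i + j)) d)"
    by (rule gap_bound[OF assms(1-3) f]) blast
  obtain q where q: "q \<ge> 0"
    "4 * card {y \<in> Y - {Max Y}. g (succ_in Y y) - g y > q} \<le> card Y"
    "\<And>j. card Y * card (dsum_upto A j q) \<le> 16 * card (dsum_upto A (2 * (i' + j)) d')"
    by (rule gap_bound[OF assms(1-3) g]) blast
  define U where "U = {y \<in> Y - {Max Y}. f (succ_in Y y) - f y \<le> p \<and> g (succ_in Y y) - g y \<le> q}"
  have "Y \<subseteq> {Max Y} \<union> {y \<in> Y - {Max Y}. f (succ_in Y y) - f y > p}
      \<union> {y \<in> Y - {Max Y}. g (succ_in Y y) - g y > q} \<union> U"
    by (auto simp: U_def)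
  hence "card Y \<le> card ({Max Y} \<union> {y \<in> Y - {Max Y}. f (succ_in Y y) - f y > p}
      \<union> {y \<in> Y - {Max Y}. g (succ_in Y y) - g y > q} \<union> U)"
    using assms(3) by (intro card_mono) (auto simp: U_def)
  also have "\<dots> \<le> 1 + card {y \<in> Y - {Max Y}. f (succ_in Y y) - f y > p}
      + card {y \<in> Y - {Max Y}. g (succ_in Y y) - g y > q} + card U"
    by (intro order_trans[OF card_Un_le] add_mono order_refl) simp
  \<comment> \<open>Two quarters are lost to large gaps, and \<open>card Y \<ge> 4\<close> lets a
    third quarter absorb the maximum.\<close>
  finally have U: "card Y \<le> 4 * card U"
    using p(2) q(2) assms(4) by linarith
  have gaps: "f (succ_in Y y) - f y \<in> dsum_upto A (2 * i) p"
             "g (succ_in Y y) - g y \<in> dsum_upto A (2 * i') q" if "y \<in> U" for y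
  proof -
    have y: "y \<in> Y - {Max Y}" using that by (auto simp: U_def)
    note s = succ_in[OF assms(3) y]
    have *: "k (succ_in Y y) - k y \<in> dsum A (2 * n)" if k: "k ` Y \<subseteq> (+) e ` dsum A n" for k e n
    proof -
      obtain v w where vw: "v \<in> dsum A n" "w \<in> dsum A n" "k (succ_in Y y) = e + v" "k y = e + w"
        using k s(1) y by blast
      thus ?thesis using dsum_diff[OF vw(1,2)] by (simp add: mult_2)
    qed
    have "f y < f (succ_in Y y)" "g y < g (succ_in Y y)"
      using strict_mono_onD[OF f(1)] strict_mono_onD[OF g(1)] s y by blast+
    thus "f (succ_in Y y) - f y \<in> dsum_upto A (2 * i) p"
         "g (succ_in Y y) - g y \<in> dsum_upto A (2 * i') q"
      using *[of f c i] *[of g c' i'] f(2) g(2) that by (auto simp: U_def)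
  qed
  have fin: "finite U" "finite (dsum_upto A (2 * i) p)" using assms(1,3) by (auto simp: U_def)
  have ne: "U \<noteq> {}" using U assms(4) by auto
  have img: "(\<lambda>y. f (succ_in Y y) - f y) ` U \<subseteq> dsum_upto A (2 * i) p"
    using gaps(1) by (rule image_subsetI)
  obtain h where h: "card U \<le> card {y \<in> U. f (succ_in Y y) - f y = h} * card (dsum_upto A (2 * i) p)"
    by (rule pigeonhole_image[OF fin(1) img fin(2) ne]) blast
  define Y' where "Y' = {y \<in> U. f (succ_in Y y) - f y = h}"
  have "(card Y)\<^sup>2 \<le> card Y * (4 * (card Y' * card (dsum_upto A (2 * i) p)))"
    unfolding power2_eq_square using U h unfolding Y'_def by (intro mult_left_mono) auto
  also have "\<dots> = 4 * card Y' * (card Y * card (dsum_upto A (2 * i) p))" by simp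
  \<comment> \<open>Order \<open>2 * i\<close> for the gaps of \<open>f\<close> becomes
    \<open>2 * (i + 2 * i) = 6 * i\<close>.\<close>
  also have "\<dots> \<le> 4 * card Y' * (16 * card (dsum_upto A (2 * (i + 2 * i)) d))"
    by (intro mult_left_mono p(3)) auto
  finally have "(card Y)\<^sup>2 \<le> 64 * card Y' * card (dsum_upto A (6 * i) d)" by simp
  thus ?thesis
    using q(3) gaps succ_in[OF assms(3)]
    by (intro that[of Y' "succ_in Y" h q]) (auto simp: Y'_def U_def)
qed

section \<open>Negative exponential series\<close>

text \<open>
  Positive combinations of decaying exponentials stay in this class under taking differences, which
  makes all iterated differences monotone; this takes the place of convexity of higher order.
\<close>

definition neg_exp_series :: "(real \<Rightarrow> real) \<Rightarrow> bool" where
  "neg_exp_series r \<longleftrightarrow>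
     (\<exists>w :: nat \<Rightarrow> real. (\<forall>n. w n > 0) \<and> (\<forall>z>0. (\<lambda>n. w n * exp (- (real (Suc n) * z))) sums (- r z)))"

text \<open>Termwise, the \<open>n\<close>-th weight is multiplied by
  \<open>1 - exp (- (real (Suc n) * h))\<close>, which is positive.\<close>

lemma neg_exp_series_diff:
  assumes "neg_exp_series r" "h > 0"
  shows "neg_exp_series (\<lambda>z. r z - r (z + h))"
proof -
  obtain w :: "nat \<Rightarrow> real" where w: "\<And>n. w n > 0"
    "\<And>z. z > 0 \<Longrightarrow> (\<lambda>n. w n * exp (- (real (Suc n) * z))) sums (- r z)"
    using assms(1) unfolding neg_exp_series_def by blast
  define v where "v n = w n * (1 - exp (- (real (Suc n) * h)))" for n
  have "v n > 0" for n
    using w(1) assms(2) by (simp add: v_def)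
  moreover have "(\<lambda>n. v n * exp (- (real (Suc n) * z))) sums (- (r z - r (z + h)))" if "z > 0" for z
  proof -
    have "(\<lambda>n. w n * exp (- (real (Suc n) * z)) - w n * exp (- (real (Suc n) * (z + h))))
        sums (- r z - - r (z + h))"
      using w(2) that assms(2) by (intro sums_diff) auto
    also have "(\<lambda>n. w n * exp (- (real (Suc n) * z)) - w n * exp (- (real (Suc n) * (z + h))))
        = (\<lambda>n. v n * exp (- (real (Suc n) * z)))"
    proof
      fix n
      have "exp (- (real (Suc n) * (z + h))) = exp (- (real (Suc n) * z)) * exp (- (real (Suc n) * h))"
        by (simp only: exp_add[symmetric] distrib_left minus_add_distrib)
      thus "w n * exp (- (real (Suc n) * z)) - w n * exp (- (real (Suc n) * (z + h)))
          = v n * exp (- (real (Suc n) * z))"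
        by (simp only: v_def right_diff_distrib left_diff_distrib mult_1_right mult_ac)
    qed
    finally show ?thesis by simp
  qed
  ultimately show ?thesis unfolding neg_exp_series_def by blast
qed

lemma neg_exp_series_strict_mono:
  assumes "neg_exp_series r"
  shows "strict_mono_on {0<..} r"
proof (rule strict_mono_onI)
  fix x y :: real assume xy: "x \<in> {0<..}" "y \<in> {0<..}" "x < y"
  have "neg_exp_series (\<lambda>z. r z - r (z + (y - x)))"
    using neg_exp_series_diff[OF assms, of "y - x"] xy(3) by simp
  then obtain w :: "nat \<Rightarrow> real" where w: "\<And>n. w n > 0"
    "(\<lambda>n. w n * exp (- (real (Suc n) * x))) sums (- (r x - r (x + (y - x))))"
    using xy(1) unfolding neg_exp_series_def by blast
  have "0 < (\<Sum>n. w n * exp (- (real (Suc n) * x)))"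
    using w by (intro suminf_pos) (auto intro: sums_summable)
  thus "r x < r y" using w(2) by (simp add: sums_iff)
qed

text \<open>The Mercator series of \<open>ln (1 - u)\<close> at \<open>u = exp (- z)\<close>, with
  weights \<open>1 / real (Suc n)\<close>.\<close>

lemma neg_exp_series_ln: "neg_exp_series (\<lambda>z. ln (1 - exp (- z)))"
  unfolding neg_exp_series_def
proof (intro exI[of _ "\<lambda>n. 1 / real (Suc n)"] conjI allI impI)
  fix z :: real assume z: "z > 0"
  define f where "f n = (-1) ^ n * (1 / real (n + 1)) * ((1 - exp (- z)) - 1) ^ Suc n" for n :: nat
  have f: "f n = - (1 / real (Suc n) * exp (- (real (Suc n) * z)))" for n
  proof -
    have "exp (- (real (Suc n) * z)) = exp (- z) ^ Suc n"
      by (subst exp_of_nat_mult[symmetric]) simp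
    thus ?thesis by (simp add: f_def power_minus[of "exp (- z)"])
  qed
  \<comment> \<open>An equation for \<open>suminf\<close> carries no convergence; that comes from
    comparison with a geometric series.\<close>
  have "summable (\<lambda>n. exp (- z) ^ Suc n)"
    using z summable_mult[OF summable_geometric[of "exp (- z)"], of "exp (- z)"] by simp
  hence "summable (\<lambda>n. - f n)"
  proof (rule summable_comparison_test')
    fix n :: nat
    have "exp (- (real (Suc n) * z)) = exp (- z) ^ Suc n"
      by (subst exp_of_nat_mult[symmetric]) simp
    thus "norm (- f n) \<le> exp (- z) ^ Suc n"
      unfolding f by (simp add: divide_le_eq)
  qed
  moreover have "ln (1 - exp (- z)) = (\<Sum>n. f n)"
    unfolding f_def using z by (intro ln_series) (auto intro: less_trans[of _ 0])
  ultimately have "(\<lambda>n. - f n) sums (- ln (1 - exp (- z)))"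
    by (metis summable_minus_iff summable_sums suminf_minus)
  thus "(\<lambda>n. 1 / real (Suc n) * exp (- (real (Suc n) * z))) sums - ln (1 - exp (- z))"
    by (simp add: f)
qed auto

text \<open>\<open>squeeze\<close> with the identity as \<open>f\<close> and \<open>r\<close> as
  \<open>g\<close>: all kept points have the same gap \<open>h\<close>, so the single function
  \<open>r z - r (z + h)\<close> records the gaps of \<open>r\<close> up to sign. The shift 0 and
  the interval \<open>{-q..-q + q}\<close> match the form of the hypothesis, so that the step can be
  repeated.\<close>

lemma neg_exp_series_squeeze:
  fixes A Y :: "real set"
  assumes "finite A" "A \<noteq> {}" "card Y \<ge> 4" and Y: "Y \<subseteq> dsum_upto A 1 D - {0}"
    and r: "neg_exp_series r" "r ` Y \<subseteq> (+) c ` dsum A i \<inter> {b..b + d}"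
  obtains Y' r' q where "Y' \<subseteq> Y" "neg_exp_series r'"
    "r' ` Y' \<subseteq> (+) 0 ` dsum A (2 * i) \<inter> {-q..-q + q}"
    "(card Y)\<^sup>2 \<le> 64 * card Y' * card (dsum_upto A 6 D)"
    "\<And>j. card Y * card (dsum_upto A j q) \<le> 16 * card (dsum_upto A (2 * (i + j)) d)"
proof -
  have fin: "finite Y" using assms by (auto intro: finite_subset)
  have "Y \<subseteq> {0<..}" using Y by force
  hence mono: "strict_mono_on Y r"
    using neg_exp_series_strict_mono[OF r(1)] by (meson monotone_on_subset)
  have id: "strict_mono_on Y (\<lambda>y. y)" "(\<lambda>y. y) ` Y \<subseteq> (+) 0 ` dsum A 1 \<inter> {0..0 + D}"
    using Y by (auto intro: strict_mono_onI)
  obtain Y' s h q where Y': "Y' \<subseteq> Y"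
    "\<And>y. y \<in> Y' \<Longrightarrow> s y \<in> Y \<and> y < s y \<and> s y - y = h"
    "\<And>y. y \<in> Y' \<Longrightarrow> r (s y) - r y \<in> dsum_upto A (2 * i) q"
    "(card Y)\<^sup>2 \<le> 64 * card Y' * card (dsum_upto A (6 * 1) D)"
    "\<And>j. card Y * card (dsum_upto A j q) \<le> 16 * card (dsum_upto A (2 * (i + j)) d)"
    by (rule squeeze[OF assms(1,2) fin assms(3) id mono r(2)]) (rule that)
  have "Y' \<noteq> {}" using Y'(4) assms(3) by auto
  hence "h > 0" using Y'(2) by fastforce
  have "r y - r (y + h) \<in> dsum A (2 * i) \<inter> {-q..0}" if "y \<in> Y'" for y
  proof -
    have "s y = y + h" using Y'(2)[OF that] by simp
    thus ?thesis using Y'(3)[OF that] dsum_uminus[of "r (s y) - r y" A "2 * i"] by auto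
  qed
  thus ?thesis
    using Y' neg_exp_series_diff[OF r(1) \<open>h > 0\<close>]
    by (intro that[of Y' "\<lambda>z. r z - r (z + h)" q]) auto
qed

section \<open>Iterated squeezing\<close>

text \<open>Tracks the loss in one squeeze from size \<open>m\<close> to size \<open>m'\<close>:
  square the first bound, multiply by \<open>M\<close>, then use the other two in turn.\<close>

lemma power_le_step:
  fixes M m m' g P a :: real
  assumes "M ^ k \<le> a * P ^ j * m" "m\<^sup>2 \<le> 64 * m' * g" "M * g \<le> 16 * P"
    "M \<ge> 0" "m \<ge> 0" "m' \<ge> 0" "P \<ge> 0" "a \<ge> 0"
  shows "M ^ (2 * k + 1) \<le> (1024 * a\<^sup>2) * P ^ (2 * j + 1) * m'"
proof -
  have "M ^ (2 * k + 1) = M * (M ^ k)\<^sup>2" by (simp add: power_even_eq)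
  also have "\<dots> \<le> M * (a * P ^ j * m)\<^sup>2"
    using assms by (intro mult_left_mono power_mono) auto
  also have "\<dots> = (a\<^sup>2 * P ^ (2 * j) * M) * m\<^sup>2"
    by (simp add: power_mult_distrib power_even_eq)
  also have "\<dots> \<le> (a\<^sup>2 * P ^ (2 * j) * M) * (64 * m' * g)"
    using assms by (intro mult_left_mono) auto
  also have "\<dots> = (64 * a\<^sup>2 * P ^ (2 * j) * m') * (M * g)" by simp
  also have "\<dots> \<le> (64 * a\<^sup>2 * P ^ (2 * j) * m') * (16 * P)"
    using assms by (intro mult_left_mono) auto
  finally show ?thesis by (simp add: mult_ac)
qed

text \<open>An \<open>n\<close>-th root; \<open>c \<ge> 1\<close> allows keeping \<open>c\<close>
  itself in place of its root.\<close>

lemma le_powr_of_power_le: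
  fixes x c P e :: real
  assumes "x ^ n \<le> c * P ^ k" "x \<ge> 0" "c \<ge> 1" "P \<ge> 1" "n > 0" "real k \<le> e * real n"
  shows "x \<le> c * P powr e"
proof (rule ccontr)
  assume "\<not> ?thesis"
  hence less: "c * P powr e < x" by simp
  have "c * P ^ k \<le> c ^ n * (P powr e) ^ n"
  proof (intro mult_mono)
    show "c \<le> c ^ n" using assms by (intro self_le_power) auto
    have "P ^ k = P powr real k" using assms by (simp add: powr_realpow)
    also have "\<dots> \<le> P powr (e * real n)" using assms by (intro powr_mono) auto
    also have "\<dots> = (P powr e) ^ n" using powr_realpow[of "P powr e" n] assms by (simp add: powr_powr)
    finally show "P ^ k \<le> (P powr e) ^ n" .
  qed (use assms in auto)
  also have "\<dots> = (c * P powr e) ^ n" by (simp add: power_mult_distrib)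
  also have "\<dots> < x ^ n" using less assms by (intro power_strict_mono) auto
  finally show False using assms(1) by simp
qed

text \<open>Three squeezes shrink \<open>Z\<close> to \<open>Y1\<close>, \<open>Y2\<close>,
  \<open>Y3\<close>. Each size is bounded below by powers of \<open>M\<close> and \<open>P\<close>,
  while the quartile bounds telescope to an upper bound \<open>4096 * P\<close> for the product of
  all four sizes.\<close>

lemma squeeze_chain:
  fixes L Z :: "real set" and D M P g :: real
  assumes L: "finite L" "L \<noteq> {}" and P: "\<And>j. j \<le> 170 \<Longrightarrow> card (dsum L j) \<le> P" "P \<ge> 1"
    and Z: "Z \<subseteq> dsum_upto L 1 D - {0}" "r ` Z \<subseteq> (+) c ` dsum L 1" "neg_exp_series r"
    and M: "M \<ge> 0" "M\<^sup>2 \<le> 64 * P * card Z" "M * card (dsum_upto L 6 D) \<le> 16 * P"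
  shows "M \<le> 2 ^ 212 * P powr (27 / 41)"
proof -
  define g where "g = real (card (dsum_upto L 6 D))"
  \<comment> \<open>If a set has fewer than four elements, its lower bound alone suffices: the
    exponents 1/2, 3/5 and 7/11 that occur are all below 27/41.\<close>
  have small: "M \<le> 2 ^ 212 * P powr (27 / 41)"
    if "M ^ n \<le> b * P ^ k * real m" "m \<le> 4" "0 \<le> b" "b * 4 \<le> 2 ^ 212" "n > 0"
       "real k \<le> 27 / 41 * real n" for n k m :: nat and b
  proof -
    have "M ^ n \<le> b * P ^ k * 4"
      using that P(2) by (intro order_trans[OF that(1)] mult_left_mono) auto
    also have "\<dots> \<le> 2 ^ 212 * P ^ k"
      using mult_right_mono[OF that(4), of "P ^ k"] P(2) by (simp add: mult_ac)
    finally show ?thesis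
      using M(1) P(2) that by (intro le_powr_of_power_le[of _ n _ _ k]) auto
  qed
  have M0: "M ^ 2 \<le> 64 * P ^ 1 * card Z" using M(2) by simp
  have Mg: "M * g \<le> 16 * P" using M(3) by (simp add: g_def)
  have real_sq: "(real m)\<^sup>2 \<le> 64 * real m' * g" if "m\<^sup>2 \<le> 64 * m' * card (dsum_upto L 6 D)" for m m'
  proof -
    have "real (m\<^sup>2) \<le> real (64 * m' * card (dsum_upto L 6 D))" using that by linarith
    thus ?thesis by (simp add: g_def)
  qed
  have finZ: "finite Z" using Z L by (auto intro: finite_subset)
  show ?thesis
  proof (cases "card Z \<ge> 4")
    case False
    thus ?thesis by (intro small[OF M0]) auto
  next
    case Z4: True
    \<comment> \<open>Any interval containing the values would do: its length is forgotten at the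
      end, when all of \<open>dsum L 170\<close> is counted.\<close>
    define b d where "b = Min (r ` Z)" and "d = Max (r ` Z) - Min (r ` Z)"
    have "r ` Z \<subseteq> {b..b + d}" using finZ by (auto simp: b_def d_def)
    hence "r ` Z \<subseteq> (+) c ` dsum L 1 \<inter> {b..b + d}" using Z(2) by blast
    then obtain Y1 r1 q1 where 1: "Y1 \<subseteq> Z" "neg_exp_series r1"
      "r1 ` Y1 \<subseteq> (+) 0 ` dsum L (2 * 1) \<inter> {-q1..-q1 + q1}"
      "(card Z)\<^sup>2 \<le> 64 * card Y1 * card (dsum_upto L 6 D)"
      "\<And>j. card Z * card (dsum_upto L j q1) \<le> 16 * card (dsum_upto L (2 * (1 + j)) d)"
      by (rule neg_exp_series_squeeze[OF L Z4 Z(1) Z(3)]) blast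
    have M1: "M ^ 5 \<le> 2 ^ 22 * P ^ 3 * card Y1"
      using power_le_step[OF M0 real_sq[OF 1(4)] Mg] M(1) P(2) by simp
    have Y1: "Y1 \<subseteq> dsum_upto L 1 D - {0}" using 1(1) Z(1) by blast
    show ?thesis
    proof (cases "card Y1 \<ge> 4")
      case False
      thus ?thesis by (intro small[OF M1]) auto
    next
      case Y14: True
      obtain Y2 r2 q2 where 2: "Y2 \<subseteq> Y1" "neg_exp_series r2"
        "r2 ` Y2 \<subseteq> (+) 0 ` dsum L (2 * (2 * 1)) \<inter> {-q2..-q2 + q2}"
        "(card Y1)\<^sup>2 \<le> 64 * card Y2 * card (dsum_upto L 6 D)"
        "\<And>j. card Y1 * card (dsum_upto L j q2) \<le> 16 * card (dsum_upto L (2 * (2 * 1 + j)) q1)"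
        by (rule neg_exp_series_squeeze[OF L Y14 Y1 1(2,3)]) blast
      have M2: "M ^ 11 \<le> 2 ^ 54 * P ^ 7 * card Y2"
        using power_le_step[OF M1 real_sq[OF 2(4)] Mg] M(1) P(2) by simp
      have Y2: "Y2 \<subseteq> dsum_upto L 1 D - {0}" using 2(1) Y1 by blast
      show ?thesis
      proof (cases "card Y2 \<ge> 4")
        case False
        thus ?thesis by (intro small[OF M2]) auto
      next
        case Y24: True
        obtain Y3 r3 q3 where 3: "Y3 \<subseteq> Y2" "neg_exp_series r3"
          "r3 ` Y3 \<subseteq> (+) 0 ` dsum L (2 * (2 * (2 * 1))) \<inter> {-q3..-q3 + q3}"
          "(card Y2)\<^sup>2 \<le> 64 * card Y3 * card (dsum_upto L 6 D)"
          "\<And>j. card Y2 * card (dsum_upto L j q3) \<le> 16 * card (dsum_upto L (2 * (2 * (2 * 1) + j)) q2)"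
          by (rule neg_exp_series_squeeze[OF L Y24 Y2 2(2,3)]) blast
        have M3: "M ^ 23 \<le> 2 ^ 118 * P ^ 15 * card Y3"
          using power_le_step[OF M2 real_sq[OF 3(4)] Mg] M(1) P(2) by simp
        have fin3: "finite Y3" using 3(1) Y2 L(1) by (auto intro: finite_subset)
        have "Y3 \<subseteq> {0<..}" using 3(1) Y2 by force
        \<comment> \<open>Injectivity turns the few values available to \<open>r3\<close> into a
          bound for \<open>card Y3\<close>, which starts the telescoping.\<close>
        hence "inj_on r3 Y3"
          using neg_exp_series_strict_mono[OF 3(2)]
          by (meson monotone_on_subset strict_mono_on_imp_inj_on)
        hence "card Y3 = card (r3 ` Y3)" by (simp add: card_image)
        also have "\<dots> \<le> card (dsum_upto L (2 * (2 * (2 * (2 * 1)))) q3)"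
          by (rule card_dsum_interval[OF L(1) _ 3(3)]) (use fin3 in simp)
        finally have c3: "card Y3 \<le> card (dsum_upto L 16 q3)" by simp
        \<comment> \<open>Each bound trades one interval for the previous one and raises the order:
          16, 40, 84, 170.\<close>
        have c2: "card Y2 * card (dsum_upto L 16 q3) \<le> 16 * card (dsum_upto L 40 q2)"
          using 3(5)[of 16] by simp
        have c1: "card Y1 * card (dsum_upto L 40 q2) \<le> 16 * card (dsum_upto L 84 q1)"
          using 2(5)[of 40] by simp
        have c0: "card Z * card (dsum_upto L 84 q1) \<le> 16 * card (dsum_upto L 170 d)"
          using 1(5)[of 84] by simp
        have "card Z * (card Y1 * (card Y2 * card Y3))
            \<le> card Z * (card Y1 * (card Y2 * card (dsum_upto L 16 q3)))"
          using c3 by (intro mult_left_mono) auto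
        also have "\<dots> \<le> card Z * (card Y1 * (16 * card (dsum_upto L 40 q2)))"
          using c2 by (intro mult_left_mono) auto
        also have "\<dots> = 16 * (card Z * (card Y1 * card (dsum_upto L 40 q2)))" by simp
        also have "\<dots> \<le> 16 * (card Z * (16 * card (dsum_upto L 84 q1)))"
          using c1 by (intro mult_left_mono) auto
        also have "\<dots> = 256 * (card Z * card (dsum_upto L 84 q1))" by simp
        also have "\<dots> \<le> 256 * (16 * card (dsum_upto L 170 d))"
          using c0 by (intro mult_left_mono) auto
        also have "\<dots> \<le> 4096 * card (dsum L 170)"
          using L(1) by (auto intro!: card_mono)
        finally have "real (card Z * (card Y1 * (card Y2 * card Y3))) \<le> real (4096 * card (dsum L 170))"
          by linarith
        also have "\<dots> \<le> 4096 * P" using P(1)[of 170] by simp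
        finally have prod: "real (card Z) * (card Y1 * (card Y2 * card Y3)) \<le> 4096 * P" by simp
        \<comment> \<open>Here 41 = 2 + 5 + 11 + 23 and 26 = 1 + 3 + 7 + 15; the last factor
          \<open>P\<close> and \<open>2 ^ 12\<close> come from \<open>prod\<close>.\<close>
        have "M ^ 41 = M ^ 2 * (M ^ 5 * (M ^ 11 * M ^ 23))" by (simp flip: power_add)
        also have "\<dots> \<le> (64 * P ^ 1 * card Z) * ((2 ^ 22 * P ^ 3 * card Y1) *
            ((2 ^ 54 * P ^ 7 * card Y2) * (2 ^ 118 * P ^ 15 * card Y3)))"
          using M(1) P(2) by (intro mult_mono M0 M1 M2 M3) auto
        also have "\<dots> = (64 * 2 ^ 22 * 2 ^ 54 * 2 ^ 118) * (P ^ 1 * P ^ 3 * P ^ 7 * P ^ 15) *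
            (card Z * (card Y1 * (card Y2 * card Y3)))"
          by (simp only: of_nat_mult mult_ac)
        also have "\<dots> = 2 ^ 200 * P ^ 26 * (card Z * (card Y1 * (card Y2 * card Y3)))"
        proof -
          have "P ^ 1 * P ^ 3 * P ^ 7 * P ^ 15 = P ^ 26"
            by (simp only: power_add[symmetric]) simp
          thus ?thesis by simp
        qed
        also have "\<dots> \<le> 2 ^ 200 * P ^ 26 * (4096 * P)"
          using prod P(2) by (intro mult_left_mono) auto
        also have "\<dots> = 2 ^ 212 * P ^ 27"
          by (simp add: power_Suc2[of P 26, simplified])
        finally show ?thesis
          using M(1) P(2) by (intro le_powr_of_power_le[of _ 41 _ _ 27]) auto
      qed
    qed
  qed
qed

section \<open>Passage to logarithms and counting of shifts\<close>

lemma card_ln_plus_ln: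
  fixes A :: "real set"
  assumes "\<And>a. a \<in> A \<Longrightarrow> a > 0"
  shows "card (ln ` A + ln ` A) = card (A * A)"
proof -
  have "ln ` A + ln ` A = ln ` (A * A)"
  proof safe
    fix x assume "x \<in> ln ` A + ln ` A"
    then obtain a b where "a \<in> A" "b \<in> A" "x = ln a + ln b" by (auto elim: set_plus_elim)
    thus "x \<in> ln ` (A * A)" using assms[of a] assms[of b]
      by (intro image_eqI[of _ _ "a * b"]) (auto simp: ln_mult intro: set_times_intro)
  next
    fix x assume "x \<in> A * A"
    then obtain a b where "a \<in> A" "b \<in> A" "x = a * b" by (auto elim: set_times_elim)
    thus "ln x \<in> ln ` A + ln ` A" using assms[of a] assms[of b]
      by (auto simp: ln_mult intro: set_plus_intro)
  qed
  moreover have "inj_on ln (A * A)"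
    using assms by (auto simp: inj_on_def elim!: set_times_elim)
  ultimately show ?thesis by (simp add: card_image)
qed

text \<open>\<open>A * A\<close> contains a dilate of \<open>A\<close>. This makes powers of
  \<open>K\<close> increase with the exponent.\<close>

lemma one_le_doubling:
  fixes A :: "real set" and K :: real
  assumes A: "finite A" "A \<noteq> {}" "\<And>a. a \<in> A \<Longrightarrow> a > 0" and K: "card (A * A) \<le> K * card A"
  shows "K \<ge> 1"
proof -
  have cA: "card A > 0" using A by (simp add: card_gt_0_iff)
  obtain a where a: "a \<in> A" using A by auto
  have "card A = card ((\<lambda>b. a * b) ` A)"
    using A(3)[OF a] by (subst card_image) (auto simp: inj_on_def)
  also have "\<dots> \<le> card (A * A)"
    using A(1) a by (intro card_mono finite_set_times) (auto intro: set_times_intro)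
  finally show ?thesis using assms(4) cA by (smt (verit) mult_le_cancel_right1 of_nat_0_less_iff of_nat_le_iff)
qed

lemma shift_intersection_bound:
  fixes A :: "real set" and K t :: real
  assumes A: "finite A" "A \<noteq> {}" "\<And>a. a \<in> A \<Longrightarrow> a > 0" and K: "card (A * A) \<le> K * card A"
    and t: "t > 0"
  shows "card {a \<in> A. a - t \<in> A} \<le> 2 ^ 212 * (K ^ 340 * card A) powr (27 / 41)"
proof -
  define L where "L = ln ` A"
  define X where "X = {a \<in> A. a - t \<in> A}"
  define P where "P = K ^ 340 * card A"
  have L: "finite L" "L \<noteq> {}" using A by (auto simp: L_def)
  have cL: "card L = card A"
    using A(3) by (auto simp: L_def inj_on_def intro!: card_image)
  have cA: "card A > 0" using A by (simp add: card_gt_0_iff)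
  have K1: "K \<ge> 1" using one_le_doubling[OF A K] .
  have LL: "card (L + L) \<le> K * card L"
    using K card_ln_plus_ln[of A] A(3) cL by (simp add: L_def)
  have Pj: "card (dsum L j) \<le> P" if "j \<le> 170" for j
  proof -
    have "card (dsum L j) \<le> K ^ (2 * j) * card A"
      using card_dsum_le[OF L LL, of j] cL by simp
    also have "\<dots> \<le> P"
      unfolding P_def using that K1 by (intro mult_right_mono power_increasing) auto
    finally show ?thesis .
  qed
  have P1: "P \<ge> 1"
    unfolding P_def using mult_mono[of 1 "K ^ 340" 1 "real (card A)"] K1 cA by (simp add: one_le_power)
  have X: "finite X" "X \<subseteq> A" "\<And>a. a \<in> X \<Longrightarrow> a > 0 \<and> a - t > 0 \<and> a \<in> A \<and> a - t \<in> A"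
    using A(1) A(3) A(3)[of "_ - t"] by (auto simp: X_def)
  show ?thesis
  proof (cases "card X \<ge> 4")
    case False
    have "(1::real) * 4 \<le> P powr (27 / 41) * 2 ^ 212"
      using P1 by (intro mult_mono) (auto simp: ge_one_powr_ge_zero)
    thus ?thesis using False by (simp add: X_def P_def mult.commute)
  next
    case X4: True
    define b d where "b = Min L" and "d = Max L - Min L"
    obtain l where l: "l \<in> L" using L by auto
    have Lsub: "L \<subseteq> (+) l ` dsum L 1 \<inter> {b..b + d}"
    proof
      fix x assume x: "x \<in> L"
      have "x \<in> (+) l ` dsum L 1"
        using dsum_1I[OF x l] by (intro image_eqI[of _ _ "x - l"]) auto
      thus "x \<in> (+) l ` dsum L 1 \<inter> {b..b + d}"
        using x L(1) by (auto simp: b_def d_def)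
    qed
    have f: "strict_mono_on X (\<lambda>a. ln (a - t))" "(\<lambda>a. ln (a - t)) ` X \<subseteq> (+) l ` dsum L 1 \<inter> {b..b + d}"
      and g: "strict_mono_on X ln" "ln ` X \<subseteq> (+) l ` dsum L 1 \<inter> {b..b + d}"
    proof -
      have "(\<lambda>a. ln (a - t)) ` X \<subseteq> L" "ln ` X \<subseteq> L"
        using X(3) by (auto simp: L_def)
      thus "(\<lambda>a. ln (a - t)) ` X \<subseteq> (+) l ` dsum L 1 \<inter> {b..b + d}"
           "ln ` X \<subseteq> (+) l ` dsum L 1 \<inter> {b..b + d}"
        using Lsub by blast+
    qed (use X(3) in \<open>auto intro!: strict_mono_onI\<close>)
    obtain U s h q where U: "U \<subseteq> X" "\<And>a. a \<in> U \<Longrightarrow> s a \<in> X \<and> a < s a \<and> ln (s a - t) - ln (a - t) = h"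
      "\<And>a. a \<in> U \<Longrightarrow> ln (s a) - ln a \<in> dsum_upto L (2 * 1) q"
      "(card X)\<^sup>2 \<le> 64 * card U * card (dsum_upto L (6 * 1) d)"
      "\<And>j. card X * card (dsum_upto L j q) \<le> 16 * card (dsum_upto L (2 * (1 + j)) d)"
      by (rule squeeze[OF L X(1) X4 f g]) blast
    define z where "z a = ln (s a) - ln a" for a
    have "U \<noteq> {}" using U(4) X4 by auto
    have h: "h > 0"
    proof -
      obtain a where a: "a \<in> U" using \<open>U \<noteq> {}\<close> by auto
      thus ?thesis using U(2)[OF a] X(3)[of a] X(3)[of "s a"] U(1) by auto
    qed
    have rel: "exp (z a) = s a / a" "exp h = (s a - t) / (a - t)" if "a \<in> U" for a
    proof -
      have *: "a > 0" "s a > 0" "a - t > 0" "s a - t > 0"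
        using U(1,2) X(3) that by blast+
      thus "exp (z a) = s a / a" by (simp add: z_def exp_diff)
      have "h = ln (s a - t) - ln (a - t)" using U(2)[OF that] by simp
      thus "exp h = (s a - t) / (a - t)" using * by (simp add: exp_diff)
    qed
    have inj: "inj_on z U"
    proof (rule inj_onI)
      fix x y assume xy: "x \<in> U" "y \<in> U" "z x = z y"
      \<comment> \<open>Both numerators reduce to \<open>s a - a\<close>, so the quotient is
        \<open>(a - t) / a\<close>, which determines \<open>a\<close>.\<close>
      have eq: "(exp (z a) - 1) / (exp h - 1) = 1 - t / a" if "a \<in> U" for a
      proof -
        have "a > 0" "a - t > 0" "s a > a" using U(1,2) X(3) that by blast+
        thus ?thesis unfolding rel[OF that] by (simp add: divide_simps)
      qed
      have "t / x = t / y" using eq[OF xy(1)] eq[OF xy(2)] xy(3) by auto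
      moreover have "x > 0" "y > 0" using xy U(1) X(3) by blast+
      ultimately show "x = y" using t by (simp add: field_simps)
    qed
    have fin: "finite U" using U(1) X(1) finite_subset by blast
    have "z ` U \<subseteq> dsum_upto L 1 q - {0}"
    proof safe
      fix a assume a: "a \<in> U"
      have *: "a \<in> A" "s a \<in> A" "a > 0" "a < s a" using U(1,2) X(3) a by blast+
      \<comment> \<open>Order 1 rather than the order 2 from \<open>squeeze\<close>, since
        \<open>a\<close> and \<open>s a\<close> both lie in \<open>A\<close>; only the bound
        \<open>q\<close> is taken from there.\<close>
      show "z a \<in> dsum L 1" unfolding z_def L_def by (intro dsum_1I imageI *)
      show "z a \<in> {0..q}" using U(3)[OF a] by (simp add: z_def)
      show False if "z a = 0" using that * by (simp add: z_def)
    qed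
    moreover have "(\<lambda>z. ln (1 - exp (- z))) ` z ` U \<subseteq> (+) (ln (exp h - 1)) ` dsum L 1"
    proof safe
      fix a assume a: "a \<in> U"
      have *: "a - t \<in> A" "s a \<in> A" "a > 0" "a < s a" "a - t > 0" using U(1,2) X(3) a by blast+
      \<comment> \<open>Eliminating \<open>s a - a\<close> leaves a quotient of two elements of
        \<open>A\<close> times a factor independent of \<open>a\<close>.\<close>
      have "1 - exp (- z a) = (exp h - 1) * ((a - t) / s a)"
        unfolding exp_minus rel[OF a] using * by (simp add: divide_simps)
      hence "ln (1 - exp (- z a)) = ln (exp h - 1) + (ln (a - t) - ln (s a))"
        using * h by (simp add: ln_mult ln_div)
      moreover have "ln (a - t) - ln (s a) \<in> dsum L 1"
        unfolding L_def by (intro dsum_1I imageI *)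
      ultimately show "ln (1 - exp (- z a)) \<in> (+) (ln (exp h - 1)) ` dsum L 1" by blast
    qed
    moreover have "(real (card X))\<^sup>2 \<le> 64 * P * card (z ` U)"
    proof -
      have "(card X)\<^sup>2 \<le> 64 * card U * card (dsum L 6)"
        using L(1) by (intro order_trans[OF U(4)] mult_left_mono card_mono) auto
      hence "real ((card X)\<^sup>2) \<le> real (64 * card U * card (dsum L 6))" by linarith
      also have "\<dots> \<le> 64 * card U * P"
        using Pj[of 6] by (simp add: mult_left_mono)
      finally show ?thesis using inj by (simp add: card_image mult_ac)
    qed
    moreover have "real (card X) * card (dsum_upto L 6 q) \<le> 16 * P"
    proof -
      have "card X * card (dsum_upto L 6 q) \<le> 16 * card (dsum L 14)"
        using L(1) by (intro order_trans[OF U(5)]) (auto intro!: card_mono)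
      hence "real (card X * card (dsum_upto L 6 q)) \<le> real (16 * card (dsum L 14))" by linarith
      also have "\<dots> \<le> 16 * P" using Pj[of 14] by simp
      finally show ?thesis by simp
    qed
    ultimately have "real (card X) \<le> 2 ^ 212 * P powr (27 / 41)"
      using L P1 Pj neg_exp_series_ln by (intro squeeze_chain[of L P "z ` U" q]) auto
    thus ?thesis by (simp add: X_def P_def)
  qed
qed

theorem theorem1p2:
  shows "\<exists>c C C\<^sub>0 :: real. c > 0 \<and> C > 0 \<and> C\<^sub>0 > 0 \<and>
    (\<forall>(A :: real set) (K :: real) (t :: real).
       finite A \<longrightarrow> (\<forall>a\<in>A. a > 0) \<longrightarrow> K > 0 \<longrightarrow> t \<noteq> 0 \<longrightarrow>
       real (card (A * A)) \<le> K * real (card A) \<longrightarrow>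
       real (card {(a, b). (a, b) \<in> A \<times> A \<and> a - b = t})
         \<le> C\<^sub>0 * K powr C * real (card A) powr (2 / 3 - c))"
\<comment> \<open>The choice \<open>c = 1 / 123\<close> gives
  \<open>2 / 3 - c = 27 / 41\<close>.\<close>
proof (rule exI[of _ "1 / 123"], rule exI[of _ 340], rule exI[of _ "2 ^ 212"], intro conjI allI impI)
  fix A :: "real set" and K t :: real
  assume A: "finite A" "\<forall>a\<in>A. a > 0" and K: "K > 0" and t: "t \<noteq> 0"
    and AA: "real (card (A * A)) \<le> K * real (card A)"
  show "real (card {(a, b). (a, b) \<in> A \<times> A \<and> a - b = t})
      \<le> 2 ^ 212 * K powr 340 * real (card A) powr (2 / 3 - 1 / 123)"
  proof (cases "A = {}")
    case False
    \<comment> \<open>For negative \<open>t\<close> the pairs are counted by their second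
      coordinate, so that the shift is positive in both cases.\<close>
    have "card {(a, b). (a, b) \<in> A \<times> A \<and> a - b = t} = card {a \<in> A. a - \<bar>t\<bar> \<in> A}"
    proof (cases "t > 0")
      case True
      thus ?thesis by (intro bij_betw_same_card[of fst] bij_betw_byWitness[of _ "\<lambda>a. (a, a - t)"]) auto
    next
      case False
      thus ?thesis by (intro bij_betw_same_card[of snd] bij_betw_byWitness[of _ "\<lambda>a. (a + t, a)"]) auto
    qed
    also have "real \<dots> \<le> 2 ^ 212 * (K ^ 340 * card A) powr (27 / 41)"
      using A False AA t by (intro shift_intersection_bound) auto
    also have "\<dots> = 2 ^ 212 * ((K ^ 340) powr (27 / 41) * card A powr (27 / 41))"
      using K by (simp add: powr_mult)
    \<comment> \<open>As \<open>K \<ge> 1\<close>, the exponent \<open>340 * 27 / 41\<close> of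
      \<open>K\<close> may be raised to 340.\<close>
    also have "\<dots> \<le> 2 ^ 212 * (K ^ 340 * card A powr (27 / 41))"
      using powr_mono[of "27 / 41" 1 "K ^ 340"] one_le_doubling[OF A(1) False _ AA] A(2)
      by (intro mult_left_mono mult_right_mono) (auto simp: one_le_power)
    also have "\<dots> = 2 ^ 212 * K powr 340 * real (card A) powr (2 / 3 - 1 / 123)"
      using K by (simp add: powr_numeral)
    finally show ?thesis .
  qed simp
qed auto

end
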